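(* Let $q$ be a complex number with $|q|<1$. Then $$\sum_{n=0}^{\infty}\frac{(-1;q)_n\,q^{n(n+1)/2}}{(q;q)_n}=\frac{(-q;q)_{\infty}\,(q^2,q^2,q^4;q^4)_{\infty}}{(q;q)_{\infty}}.$$
   Context: For $n\in\mathbb Z_{\ge 0}\cup\{\infty\}$, $(a;q)_n:=\prod_{j=0}^{n-1}(1-aq^j)$ and $(a_1,\ldots,a_r;q)_n:=\prod_{j=1}^r(a_j;q)_n$ (and similarly with base $q$ replaced by a power of $q$). *)

theory Defs
  imports "HOL-Analysis.Infinite_Products" "HOL-Library.Extended_Nat"
begin

text \<open>
  The \<open>q\<close>-shifted factorial \<open>(a;q)\<^sub>n\<close> for \<open>n\<close> a natural number or infinity. The infinite
  product converges whenever \<open>norm q < 1\<close>; note that \<^const>\<open>prodinf\<close> allows vanishing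
  factors, in which case its value is 0.
\<close>
definition qpoch :: "complex \<Rightarrow> complex \<Rightarrow> enat \<Rightarrow> complex" where
  "qpoch a q n = (case n of
     enat m \<Rightarrow> (\<Prod>j<m. 1 - a * q ^ j)
   | \<infinity> \<Rightarrow> (\<Prod>j. 1 - a * q ^ j))"

text \<open>The multi-parameter version \<open>(a\<^sub>1,\<dots>,a\<^sub>r;q)\<^sub>n\<close>.\<close>
definition qpochs :: "complex list \<Rightarrow> complex \<Rightarrow> enat \<Rightarrow> complex" where
  "qpochs as q n = prod_list (map (\<lambda>a. qpoch a q n) as)"

end

theory Submission imports Defs begin

text \<open>
  Write \<open>S(a, z) = (\<Sum>n. (a;q)\<^sub>n z\<^sup>n q\<^bsup>n(n-1)/2\<^esup> / (q;q)\<^sub>n)\<close>. Termwise,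
  \<open>S(a, z) - S(a q, z) = -a z S(a q, z q)\<close> and \<open>S(a, z) - S(a, z q) = z (1 - a) S(a q, z q)\<close>.
  At \<open>z = 1\<close> these combine to \<open>T(a) = (1 - a q) T(a q\<^sup>2)\<close> for \<open>T(a) = S(a, q)\<close>, and iterating
  gives \<open>T(a) = (a q;q\<^sup>2)\<^sub>\<infinity> T(0)\<close>. Since \<open>T(1) = 1\<close>, this determines
  \<open>T(0) = 1 / (q;q\<^sup>2)\<^sub>\<infinity>\<close>; the theorem is the case \<open>a = -1\<close> (Lebesgue's identity).
\<close>

section \<open>Infinite \<open>q\<close>-shifted factorials\<close>

lemma qpoch_enat: "qpoch a q (enat n) = (\<Prod>j<n. 1 - a * q ^ j)"
  by (simp add: qpoch_def)

lemma norm_power2_less_1: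
  fixes q :: complex
  assumes "norm q < 1"
  shows "norm (q^2) < 1"
  using assms by (simp add: norm_power power_less_one_iff)

lemma convergent_prod_qpoch:
  fixes a q :: complex
  assumes "norm q < 1"
  shows "convergent_prod (\<lambda>j. 1 - a * q ^ j)"
proof (intro abs_convergent_prod_imp_convergent_prod summable_imp_abs_convergent_prod)
  show "summable (\<lambda>i. norm (1 - a * q ^ i - 1))"
    using assms by (simp add: norm_mult norm_power summable_mult summable_geometric)
qed

text \<open>Bridge for the product identities below: each is checked on finite products and carried
  to infinity by uniqueness of limits. Vanishing factors do no harm here.\<close>

lemma qpoch_LIMSEQ:
  assumes "norm q < 1"
  shows "(\<lambda>n. qpoch a q (enat n)) \<longlonglongrightarrow> qpoch a q \<infinity>"
proof -
  have "(\<lambda>n. \<Prod>j\<le>n. 1 - a * q ^ j) \<longlonglongrightarrow> (\<Prod>j. 1 - a * q ^ j)"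
    by (rule convergent_prod_LIMSEQ[OF convergent_prod_qpoch[OF assms]])
  hence "(\<lambda>n. qpoch a q (enat (Suc n))) \<longlonglongrightarrow> qpoch a q \<infinity>"
    by (simp add: qpoch_def lessThan_Suc_atMost)
  thus ?thesis
    by (rule LIMSEQ_imp_Suc)
qed

lemma one_minus_power_nonzero:
  fixes q :: complex
  assumes "norm q < 1"
  shows "1 - q * q ^ j \<noteq> 0"
proof
  assume "1 - q * q ^ j = 0"
  hence "norm (q ^ Suc j) = 1" by simp
  moreover have "norm (q ^ Suc j) < 1"
    unfolding norm_power using assms by (simp only: power_less_one_iff norm_ge_zero zero_less_Suc)
  ultimately show False by simp
qed

lemma qpoch_self_nonzero:
  assumes "norm q < 1"
  shows "qpoch q q \<infinity> \<noteq> 0"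
  using prodinf_nonzero[OF convergent_prod_qpoch[OF assms, of q]] one_minus_power_nonzero[OF assms]
  by (simp add: qpoch_def)

text \<open>Separates the factors with even exponent \<open>j\<close> from those with odd
  \<open>j\<close>; the first \<open>2 * n\<close> factors give \<open>n\<close> of each
  kind.\<close>

lemma qpoch_split:
  assumes "norm q < 1"
  shows "qpoch a q \<infinity> = qpoch a (q^2) \<infinity> * qpoch (a * q) (q^2) \<infinity>"
proof -
  have "qpoch a (q^2) (enat n) * qpoch (a * q) (q^2) (enat n) = qpoch a q (enat (2 * n))" for n
  proof (induction n)
    case (Suc n)
    have "2 * Suc n = Suc (Suc (2 * n))" by simp
    moreover have "(q^2) ^ n = q ^ (2 * n)" by (simp add: power_mult)
    ultimately show ?case using Suc by (simp add: qpoch_enat mult_ac)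
  qed (simp add: qpoch_enat)
  moreover have "(\<lambda>n. qpoch a q (enat (2 * n))) \<longlonglongrightarrow> qpoch a q \<infinity>"
    using LIMSEQ_subseq_LIMSEQ[OF qpoch_LIMSEQ[OF assms], of "\<lambda>n. 2 * n"]
    by (simp add: o_def strict_mono_def)
  ultimately show ?thesis
    using tendsto_mult[OF qpoch_LIMSEQ[of "q^2" a] qpoch_LIMSEQ[of "q^2" "a * q"]]
      norm_power2_less_1[OF assms]
    by (metis (no_types, lifting) LIMSEQ_unique ext)
qed

text \<open>Factorwise this is (1 - x)(1 + x) = 1 - x^2.\<close>

lemma qpoch_mult_minus:
  assumes "norm q < 1"
  shows "qpoch a q \<infinity> * qpoch (-a) q \<infinity> = qpoch (a^2) (q^2) \<infinity>"
proof -
  have "qpoch a q (enat n) * qpoch (-a) q (enat n) = qpoch (a^2) (q^2) (enat n)" for n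
    unfolding qpoch_enat prod.distrib[symmetric]
    by (intro prod.cong refl) (simp add: algebra_simps power2_eq_square power_mult_distrib)
  thus ?thesis
    using tendsto_mult[OF qpoch_LIMSEQ[OF assms, of a] qpoch_LIMSEQ[OF assms, of "-a"]]
      qpoch_LIMSEQ[OF norm_power2_less_1[OF assms], of "a^2"]
    by (simp add: LIMSEQ_unique)
qed

text \<open>Euler's identity between partitions into odd parts and into distinct parts. Both
  preceding lemmas apply to (q;q), which is nonzero and cancels.\<close>

lemma qpoch_odd_inverse:
  assumes "norm q < 1"
  shows "qpoch q (q^2) \<infinity> * qpoch (-q) q \<infinity> = 1"
proof -
  have "qpoch q q \<infinity> = qpoch q (q^2) \<infinity> * (qpoch q q \<infinity> * qpoch (-q) q \<infinity>)"
    using qpoch_split[OF assms, of q] qpoch_mult_minus[OF assms, of q]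
    by (simp add: power2_eq_square)
  thus ?thesis
    using qpoch_self_nonzero[OF assms] by (simp add: mult.left_commute)
qed

section \<open>Lebesgue's identity\<close>

definition lebesgue_term :: "complex \<Rightarrow> complex \<Rightarrow> complex \<Rightarrow> nat \<Rightarrow> complex" where
  "lebesgue_term q a z n =
     qpoch a q (enat n) * z ^ n * q ^ (n choose 2) / qpoch q q (enat n)"

definition lebesgue_sum :: "complex \<Rightarrow> complex \<Rightarrow> complex \<Rightarrow> complex" where
  "lebesgue_sum q a z = (\<Sum>n. lebesgue_term q a z n)"

lemma Suc_choose_two: "Suc n choose 2 = (n choose 2) + n"
  by (simp add: numeral_2_eq_2)

lemma qpoch_shift: "qpoch a q (enat (Suc n)) = (1 - a) * qpoch (a * q) q (enat n)"
  unfolding qpoch_enat prod.lessThan_Suc_shift by (simp add: mult.assoc)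

text \<open>With (aq;q)_n pulled out, the numerators differ by (1 - a) - (1 - a q^(n+1)) = -a (1 -
  q^(n+1)), which cancels the last factor of the denominator. The spare q^n turns z^n into
  (zq)^n.\<close>

lemma lebesgue_term_diff_param:
  assumes "norm q < 1"
  shows "lebesgue_term q a z (Suc n) - lebesgue_term q (a * q) z (Suc n) =
           - a * z * lebesgue_term q (a * q) (z * q) n"
proof -
  define P where "P = qpoch (a * q) q (enat n)"
  define Q where "Q = qpoch q q (enat n)"
  define s where "s = 1 - q * q ^ n"
  have s: "s \<noteq> 0" unfolding s_def by (rule one_minus_power_nonzero[OF assms])
  have "qpoch (a * q) q (enat (Suc n)) = P * (1 - a * q * q ^ n)"
    and "qpoch q q (enat (Suc n)) = Q * s"
    by (simp_all add: P_def Q_def s_def qpoch_enat)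
  note factors = this
  have "lebesgue_term q a z (Suc n) - lebesgue_term q (a * q) z (Suc n) =
      (- a * s) * (P * z ^ Suc n * q ^ ((n choose 2) + n)) / (Q * s)"
    unfolding lebesgue_term_def qpoch_shift[of a] Suc_choose_two P_def[symmetric]
      factors diff_divide_distrib[symmetric]
    by (rule arg_cong[where f = "\<lambda>x. x / _"]) (simp add: s_def algebra_simps)
  also have "\<dots> = - a * (P * z ^ Suc n * q ^ ((n choose 2) + n)) / Q"
    using s by simp
  finally show ?thesis
    by (simp add: lebesgue_term_def P_def Q_def power_add power_mult_distrib mult_ac)
qed

text \<open>The same cancellation, now from z^(n+1) - (zq)^(n+1) = z^(n+1) (1 - q^(n+1)).\<close>

lemma lebesgue_term_diff_arg:
  assumes "norm q < 1"
  shows "lebesgue_term q a z (Suc n) - lebesgue_term q a (z * q) (Suc n) =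
           z * (1 - a) * lebesgue_term q (a * q) (z * q) n"
proof -
  define P where "P = qpoch (a * q) q (enat n)"
  define Q where "Q = qpoch q q (enat n)"
  define s where "s = 1 - q * q ^ n"
  have s: "s \<noteq> 0" unfolding s_def by (rule one_minus_power_nonzero[OF assms])
  have factor: "qpoch q q (enat (Suc n)) = Q * s"
    by (simp add: Q_def s_def qpoch_enat)
  have "lebesgue_term q a z (Suc n) - lebesgue_term q a (z * q) (Suc n) =
      s * ((1 - a) * P * z ^ Suc n * q ^ ((n choose 2) + n)) / (Q * s)"
    unfolding lebesgue_term_def qpoch_shift[of a] Suc_choose_two P_def[symmetric]
      factor diff_divide_distrib[symmetric]
    by (rule arg_cong[where f = "\<lambda>x. x / _"]) (simp add: s_def algebra_simps power_mult_distrib)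
  also have "\<dots> = (1 - a) * P * z ^ Suc n * q ^ ((n choose 2) + n) / Q"
    using s by simp
  finally show ?thesis
    by (simp add: lebesgue_term_def P_def Q_def power_add power_mult_distrib mult_ac)
qed

section \<open>Convergence, uniformly for bounded \<open>a\<close>\<close>

definition lebesgue_majorant :: "complex \<Rightarrow> real \<Rightarrow> complex \<Rightarrow> nat \<Rightarrow> real" where
  "lebesgue_majorant q A z n =
     ((1 + A) * norm z / (1 - norm q)) ^ n * norm q ^ (n choose 2)"

text \<open>Each numerator factor has norm at most \<open>1 + A\<close>, each denominator factor at
  least \<open>1 - norm q\<close>. Only the bound \<open>A\<close> enters, so one majorant serves a
  whole bounded sequence of parameters.\<close>

lemma norm_lebesgue_term_le:
  assumes q: "norm q < 1" and a: "norm a \<le> A"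
  shows "norm (lebesgue_term q a z n) \<le> lebesgue_majorant q A z n"
proof -
  have pow: "norm (q ^ j) \<le> 1" for j
    using q by (simp add: norm_power power_le_one)
  have "norm (qpoch a q (enat n)) \<le> (\<Prod>j<n. 1 + A)"
    unfolding qpoch_enat prod_norm[symmetric]
  proof (intro prod_mono conjI norm_ge_zero)
    fix j
    have "norm (1 - a * q ^ j) \<le> 1 + norm a * norm (q ^ j)"
      using norm_triangle_ineq4[of 1 "a * q ^ j"] by (simp add: norm_mult)
    also have "norm a * norm (q ^ j) \<le> A * 1"
      using a pow by (intro mult_mono) (auto intro: order_trans[OF norm_ge_zero])
    finally show "norm (1 - a * q ^ j) \<le> 1 + A" by simp
  qed
  hence num: "norm (qpoch a q (enat n)) \<le> (1 + A) ^ n" by simp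
  have "(\<Prod>j<n. 1 - norm q) \<le> norm (qpoch q q (enat n))"
    unfolding qpoch_enat prod_norm[symmetric]
  proof (intro prod_mono conjI)
    fix j
    have "norm (q * q ^ j) \<le> norm q * 1"
      unfolding norm_mult by (intro mult_left_mono pow norm_ge_zero)
    thus "1 - norm q \<le> norm (1 - q * q ^ j)"
      using norm_triangle_ineq2[of 1 "q * q ^ j"] by simp
    show "0 \<le> 1 - norm q" using q by simp
  qed
  hence den: "(1 - norm q) ^ n \<le> norm (qpoch q q (enat n))" by simp
  have "norm (lebesgue_term q a z n) =
      norm (qpoch a q (enat n)) * (norm z ^ n * norm q ^ (n choose 2)) / norm (qpoch q q (enat n))"
    by (simp add: lebesgue_term_def norm_mult norm_divide norm_power mult_ac)
  also have "\<dots> \<le> (1 + A) ^ n * (norm z ^ n * norm q ^ (n choose 2)) / (1 - norm q) ^ n"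
    using q num den order_trans[OF norm_ge_zero num]
    by (intro frac_le mult_right_mono mult_nonneg_nonneg zero_less_power) auto
  finally show ?thesis
    by (simp add: lebesgue_majorant_def power_divide power_mult_distrib mult_ac)
qed

text \<open>The quadratic exponent beats any geometric growth: consecutive ratios are
  \<open>K * norm q ^ n\<close>, which tends to 0. Absolute values are taken since \<open>A\<close>
  is arbitrary and \<open>K\<close> may be negative.\<close>

lemma summable_lebesgue_majorant:
  assumes "norm q < 1"
  shows "summable (lebesgue_majorant q A z)"
proof -
  define K where "K = (1 + A) * norm z / (1 - norm q)"
  have "(\<lambda>n. \<bar>K\<bar> * norm q ^ n) \<longlonglongrightarrow> \<bar>K\<bar> * 0"
    using assms by (intro tendsto_intros LIMSEQ_power_zero) simp
  hence "eventually (\<lambda>n. \<bar>K\<bar> * norm q ^ n < 1/2) sequentially"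
    by (rule order_tendstoD) simp
  then obtain N where N: "\<bar>K\<bar> * norm q ^ n < 1/2" if "n \<ge> N" for n
    by (auto simp: eventually_sequentially)
  show ?thesis
  proof (rule summable_ratio_test[of "1/2" N])
    fix n assume "N \<le> n"
    have "norm (lebesgue_majorant q A z (Suc n)) =
        \<bar>K\<bar> * norm q ^ n * norm (lebesgue_majorant q A z n)"
      unfolding lebesgue_majorant_def K_def[symmetric]
      by (simp add: Suc_choose_two power_add abs_mult power_abs mult_ac)
    also have "\<dots> \<le> 1/2 * norm (lebesgue_majorant q A z n)"
      using N[OF \<open>N \<le> n\<close>] by (intro mult_right_mono) auto
    finally show "norm (lebesgue_majorant q A z (Suc n)) \<le> 1/2 * norm (lebesgue_majorant q A z n)" .
  qed simp
qed

lemma lebesgue_term_sums: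
  assumes "norm q < 1"
  shows "lebesgue_term q a z sums lebesgue_sum q a z"
  unfolding lebesgue_sum_def
  \<comment> \<open>The majorant is taken with \<open>A = norm a\<close>.\<close>
  using summable_comparison_test'[OF summable_lebesgue_majorant[OF assms]
      norm_lebesgue_term_le[OF assms order_refl]]
  by (rule summable_sums)

lemma lebesgue_term_0 [simp]: "lebesgue_term q a z 0 = 1"
  by (simp add: lebesgue_term_def qpoch_enat binomial_eq_0)

section \<open>Functional equations of the sum\<close>

lemma lebesgue_sum_diff_param:
  assumes "norm q < 1"
  shows "lebesgue_sum q a z - lebesgue_sum q (a * q) z = - a * z * lebesgue_sum q (a * q) (z * q)"
proof -
  \<comment> \<open>The termwise relation starts at index 1; both omitted initial terms are 1 and
    cancel.\<close>
  have "(\<lambda>n. lebesgue_term q a z (Suc n) - lebesgue_term q (a * q) z (Suc n)) sums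
      ((lebesgue_sum q a z - 1) - (lebesgue_sum q (a * q) z - 1))"
    using lebesgue_term_sums[OF assms, of a z] lebesgue_term_sums[OF assms, of "a * q" z]
    by (intro sums_diff) (simp_all add: sums_Suc_iff)
  moreover have "(\<lambda>n. - a * z * lebesgue_term q (a * q) (z * q) n) sums
      (- a * z * lebesgue_sum q (a * q) (z * q))"
    by (intro sums_mult lebesgue_term_sums assms)
  ultimately show ?thesis
    unfolding lebesgue_term_diff_param[OF assms] using sums_unique2 by fastforce
qed

lemma lebesgue_sum_diff_arg:
  assumes "norm q < 1"
  shows "lebesgue_sum q a z - lebesgue_sum q a (z * q) =
           z * (1 - a) * lebesgue_sum q (a * q) (z * q)"
proof -
  have "(\<lambda>n. lebesgue_term q a z (Suc n) - lebesgue_term q a (z * q) (Suc n)) sums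
      ((lebesgue_sum q a z - 1) - (lebesgue_sum q a (z * q) - 1))"
    using lebesgue_term_sums[OF assms, of a z] lebesgue_term_sums[OF assms, of a "z * q"]
    by (intro sums_diff) (simp_all add: sums_Suc_iff)
  moreover have "(\<lambda>n. z * (1 - a) * lebesgue_term q (a * q) (z * q) n) sums
      (z * (1 - a) * lebesgue_sum q (a * q) (z * q))"
    by (intro sums_mult lebesgue_term_sums assms)
  ultimately show ?thesis
    unfolding lebesgue_term_diff_arg[OF assms] using sums_unique2 by fastforce
qed

lemma lebesgue_sum_step:
  assumes "norm q < 1"
  shows "lebesgue_sum q a q = (1 - a * q) * lebesgue_sum q (a * q^2) q"
proof -
  have "lebesgue_sum q a 1 - lebesgue_sum q (a * q) 1 = - a * lebesgue_sum q (a * q) q"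
    using lebesgue_sum_diff_param[OF assms, of a 1] by simp
  moreover have "lebesgue_sum q a 1 - lebesgue_sum q a q = (1 - a) * lebesgue_sum q (a * q) q"
    using lebesgue_sum_diff_arg[OF assms, of a 1] by simp
  moreover have "lebesgue_sum q (a * q) 1 - lebesgue_sum q (a * q) q =
      (1 - a * q) * lebesgue_sum q (a * q^2) q"
    using lebesgue_sum_diff_arg[OF assms, of "a * q" 1] by (simp add: power2_eq_square mult_ac)
  \<comment> \<open>Subtracting the second equation from the first leaves T(a) = S(aq, 1) - S(aq,
    q), because a + (1 - a) = 1; the third evaluates this difference.\<close>
  ultimately show ?thesis by algebra
qed

section \<open>Iteration and passage to the limit\<close>

lemma lebesgue_sum_iterate:
  assumes "norm q < 1"
  shows "lebesgue_sum q a q = qpoch (a * q) (q^2) (enat n) * lebesgue_sum q (a * (q^2) ^ n) q"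
proof (induction n)
  case (Suc n)
  show ?case
    by (subst Suc, subst lebesgue_sum_step[OF assms]) (simp add: qpoch_enat mult_ac)
qed (simp add: qpoch_enat)

text \<open>Tannery's theorem, i.e. dominated convergence for series: each term is a polynomial in
  the parameter, and the majorant is independent of \<open>n\<close>.\<close>

lemma lebesgue_sum_tendsto_0:
  assumes q: "norm q < 1" and b: "b \<longlonglongrightarrow> 0" "\<And>n. norm (b n) \<le> A"
  shows "(\<lambda>n. lebesgue_sum q (b n) z) \<longlonglongrightarrow> lebesgue_sum q 0 z"
  unfolding lebesgue_sum_def
proof (rule tannerys_theorem[THEN conjunct2, THEN conjunct2])
  show "(\<lambda>n. lebesgue_term q (b n) z k) \<longlonglongrightarrow> lebesgue_term q 0 z k" for k
    unfolding lebesgue_term_def qpoch_enat divide_inverse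
    by (intro tendsto_intros b)
  show "summable (lebesgue_majorant q A z)"
    by (rule summable_lebesgue_majorant[OF q])
  show "eventually (\<lambda>(k, n). norm (lebesgue_term q (b n) z k) \<le> lebesgue_majorant q A z k)
      (at_top \<times>\<^sub>F sequentially)"
    by (intro always_eventually) (auto intro: norm_lebesgue_term_le q b)
qed simp

lemma lebesgue_sum_factor:
  assumes "norm q < 1"
  shows "lebesgue_sum q a q = qpoch (a * q) (q^2) \<infinity> * lebesgue_sum q 0 q"
proof -
  note q2 = norm_power2_less_1[OF assms]
  have "norm (a * (q^2) ^ n) \<le> norm a" for n
    using power_le_one[of "norm (q^2)" n] q2
    by (simp add: norm_mult norm_power mult_left_le)
  moreover have "(\<lambda>n. a * (q^2) ^ n) \<longlonglongrightarrow> 0"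
    using tendsto_mult[OF tendsto_const LIMSEQ_power_zero[OF q2], of a] by simp
  ultimately have "(\<lambda>n. lebesgue_sum q (a * (q^2) ^ n) q) \<longlonglongrightarrow> lebesgue_sum q 0 q"
    by (intro lebesgue_sum_tendsto_0[OF assms])
  hence "(\<lambda>n. qpoch (a * q) (q^2) (enat n) * lebesgue_sum q (a * (q^2) ^ n) q) \<longlonglongrightarrow>
      qpoch (a * q) (q^2) \<infinity> * lebesgue_sum q 0 q"
    by (intro tendsto_mult qpoch_LIMSEQ q2)
  \<comment> \<open>By the iteration this convergent sequence is constant, so its value equals the
    limit.\<close>
  thus ?thesis
    unfolding lebesgue_sum_iterate[OF assms, symmetric] by (simp add: LIMSEQ_const_iff)
qed

text \<open>(1;q)_n contains the factor 1 - 1 once n > 0. This value fixes the constant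
  T(0).\<close>

lemma lebesgue_sum_1: "lebesgue_sum q 1 z = 1"
proof -
  have "lebesgue_term q 1 z n = 0" if "n \<notin> {0}" for n
    using that by (cases n) (simp_all add: lebesgue_term_def qpoch_shift)
  hence "lebesgue_sum q 1 z = (\<Sum>n\<in>{0}. lebesgue_term q 1 z n)"
    unfolding lebesgue_sum_def by (intro suminf_finite) auto
  thus ?thesis by simp
qed

section \<open>Product evaluation and the case \<open>a = -1\<close>\<close>

theorem lebesgue_identity:
  assumes "norm q < 1"
  shows "(\<lambda>n. qpoch a q (enat n) * q ^ (n * (n + 1) div 2) / qpoch q q (enat n)) sums
           (qpoch (-q) q \<infinity> * qpoch (a * q) (q^2) \<infinity>)"
proof -
  have "qpoch q (q^2) \<infinity> * lebesgue_sum q 0 q = 1"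
    using lebesgue_sum_factor[OF assms, of 1] by (simp add: lebesgue_sum_1)
  \<comment> \<open>Both sides are inverse to (q;q^2), hence equal.\<close>
  with qpoch_odd_inverse[OF assms] have "lebesgue_sum q 0 q = qpoch (-q) q \<infinity>"
    by algebra
  hence sum_eq: "lebesgue_sum q a q = qpoch (-q) q \<infinity> * qpoch (a * q) (q^2) \<infinity>"
    using lebesgue_sum_factor[OF assms, of a] by simp
  have "n * (n + 1) div 2 = n + (n choose 2)" for n :: nat
    using choose_two[of "Suc n"] Suc_choose_two[of n] by (simp add: mult.commute)
  hence "(\<lambda>n. qpoch a q (enat n) * q ^ (n * (n + 1) div 2) / qpoch q q (enat n)) =
      lebesgue_term q a q"
    by (intro ext) (simp only: lebesgue_term_def power_add mult.assoc)
  thus ?thesis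
    using lebesgue_term_sums[OF assms, of a q] by (simp only: sum_eq)
qed

theorem theorem3p2:
  fixes q :: complex
  assumes "norm q < 1"
  shows "(\<lambda>n. qpoch (-1) q (enat n) * q ^ (n * (n + 1) div 2) / qpoch q q (enat n)) sums
           (qpoch (-q) q \<infinity> * qpochs [q^2, q^2, q^4] (q^4) \<infinity> / qpoch q q \<infinity>)"
proof -
  note q2 = norm_power2_less_1[OF assms]
  \<comment> \<open>It remains to identify the quotient of products with (-q;q^2). One factor
    (q^2;q^4) merges with (q^4;q^4) into (q^2;q^2) = (q;q)(-q;q); the other splits as
    (q;q^2)(-q;q^2). Euler's identity then removes (q;q^2)(-q;q).\<close>
  have "qpoch (q^2) (q^2) \<infinity> = qpoch (q^2) (q^4) \<infinity> * qpoch (q^4) (q^4) \<infinity>"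
    using qpoch_split[OF q2, of "q^2"] by (simp flip: power_mult power_add)
  moreover have "qpoch q (q^2) \<infinity> * qpoch (-q) (q^2) \<infinity> = qpoch (q^2) (q^4) \<infinity>"
    using qpoch_mult_minus[OF q2, of q] by (simp flip: power_mult)
  moreover have "qpoch q q \<infinity> * qpoch (-q) q \<infinity> = qpoch (q^2) (q^2) \<infinity>"
    by (rule qpoch_mult_minus[OF assms])
  ultimately have "qpochs [q^2, q^2, q^4] (q^4) \<infinity> =
      qpoch q q \<infinity> * (qpoch q (q^2) \<infinity> * qpoch (-q) q \<infinity>) * qpoch (-q) (q^2) \<infinity>"
    by (simp add: qpochs_def mult_ac)
  hence "qpochs [q^2, q^2, q^4] (q^4) \<infinity> / qpoch q q \<infinity> = qpoch (-q) (q^2) \<infinity>"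
    using qpoch_self_nonzero[OF assms] by (simp add: qpoch_odd_inverse[OF assms])
  thus ?thesis
    using lebesgue_identity[OF assms, of "-1"] by (simp flip: times_divide_eq_right)
qed

end
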